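(* Suppose $\kappa$ is an uncountable cardinal. If $\mathsf{BA}^-_\kappa$ holds, then $2^{\aleph_0} = 2^{\kappa}$.
   Context: All topological spaces are assumed separable and metrizable. A nonempty space is $\kappa$-crowded if every nonempty open subset has size $\kappa$. A space is zero-dimensional if it has a basis of clopen sets. For a cardinal $\kappa \le 2^{\aleph_0}$, $\mathsf{BA}^-_\kappa$ is the statement that every pair of zero-dimensional, $\kappa$-crowded spaces are homeomorphic. *)

theory Defs
  imports "HOL-Analysis.Analysis"
begin

unbundle cardinal_syntax
no_notation elt_set_eq (infix "=o" 50)

definition zero_dimensional :: "'a topology \<Rightarrow> bool" where
  "zero_dimensional X \<longleftrightarrow>
     (\<exists>\<B>. (\<forall>B\<in>\<B>. openin X B \<and> closedin X B) \<and> openin X = arbitrary union_of (\<lambda>B. B \<in> \<B>))"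

definition crowded :: "'k rel \<Rightarrow> 'a topology \<Rightarrow> bool" where
  "crowded \<kappa> X \<longleftrightarrow>
     topspace X \<noteq> {} \<and> (\<forall>U. openin X U \<and> U \<noteq> {} \<longrightarrow> |U| =o \<kappa>)"

text \<open>
  A quantifier cannot range over spaces of arbitrary type, so the spaces below have their points
  among the reals (with an arbitrary topology on an arbitrary set of reals, unrelated to the usual
  one). For \<open>\<kappa> \<le> 2\<^sup>\<aleph>\<^sup>0\<close> nothing is lost, since a \<open>\<kappa>\<close>-crowded space has exactly \<open>\<kappa>\<close> points: see
  \<open>BA_minus_all_types\<close> below.
\<close>

definition BA_minus :: "'k rel \<Rightarrow> bool" where
  "BA_minus \<kappa> \<longleftrightarrow>
     (\<forall>(X :: real topology) (Y :: real topology).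
        separable_space X \<and> metrizable_space X \<and> zero_dimensional X \<and> crowded \<kappa> X \<and>
        separable_space Y \<and> metrizable_space Y \<and> zero_dimensional Y \<and> crowded \<kappa> Y \<longrightarrow>
        X homeomorphic_space Y)"

lemma zero_dimensional_iff:
  "zero_dimensional X \<longleftrightarrow>
     (\<forall>U x. openin X U \<and> x \<in> U \<longrightarrow> (\<exists>V. openin X V \<and> closedin X V \<and> x \<in> V \<and> V \<subseteq> U))"
  (is "_ \<longleftrightarrow> ?R")
proof
  assume "zero_dimensional X"
  then show ?R
    unfolding zero_dimensional_def openin_topology_base_unique by meson
next
  assume R: ?R
  show "zero_dimensional X"
    unfolding zero_dimensional_def openin_topology_base_unique
    by (rule exI [where x = "{V. openin X V \<and> closedin X V}"]) (use R in auto)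
qed

lemma homeomorphic_map_zero_dimensional:
  assumes f: "homeomorphic_map X Y f" and X: "zero_dimensional X"
  shows "zero_dimensional Y"
  unfolding zero_dimensional_iff
proof (intro allI impI)
  fix U y assume U: "openin Y U \<and> y \<in> U"
  define W where "W = {x \<in> topspace X. f x \<in> U}"
  have W: "openin X W"
    unfolding W_def using U f homeomorphic_imp_continuous_map openin_continuous_map_preimage by blast
  have "y \<in> f ` topspace X"
    using U openin_subset [of Y U] unfolding homeomorphic_imp_surjective_map [OF f] by blast
  then obtain x where x: "x \<in> topspace X" "f x = y"
    by blast
  then have "x \<in> W" using U by (simp add: W_def)
  then obtain V where V: "openin X V" "closedin X V" "x \<in> V" "V \<subseteq> W"
    using W X unfolding zero_dimensional_iff by blast
  have "openin Y (f ` V)"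
    using V f homeomorphic_map_openness_eq by blast
  moreover have "closedin Y (f ` V)"
    using V f homeomorphic_map_closedness_eq by blast
  moreover have "y \<in> f ` V" "f ` V \<subseteq> U" using V x by (auto simp: W_def)
  ultimately show "\<exists>V. openin Y V \<and> closedin Y V \<and> y \<in> V \<and> V \<subseteq> U" by blast
qed

lemma homeomorphic_map_crowded:
  assumes f: "homeomorphic_map X Y f" and X: "crowded \<kappa> X"
  shows "crowded \<kappa> Y"
proof -
  have "|U| =o \<kappa>" if U: "openin Y U" "U \<noteq> {}" for U
  proof -
    define W where "W = {x \<in> topspace X. f x \<in> U}"
    have W: "openin X W"
      unfolding W_def using U f homeomorphic_imp_continuous_map openin_continuous_map_preimage by blast
    have im: "f ` W = U"
      using homeomorphic_imp_surjective_map [OF f] openin_subset [OF U(1)] by (auto simp: W_def)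
    have inj: "inj_on f W"
      using inj_on_subset [OF homeomorphic_imp_injective_map [OF f]] by (auto simp: W_def)
    have "|W| =o |U|"
      using inj im card_of_ordIso [of W U] by (auto simp: bij_betw_def)
    moreover have "|W| =o \<kappa>" using X W im U unfolding crowded_def by blast
    ultimately show ?thesis using ordIso_transitive [OF ordIso_symmetric] by blast
  qed
  moreover have "topspace Y \<noteq> {}"
    using homeomorphic_imp_surjective_map [OF f] X by (auto simp: crowded_def)
  ultimately show ?thesis unfolding crowded_def by blast
qed

lemma homeomorphic_real_copy:
  fixes X :: "'a topology"
  assumes \<kappa>: "\<kappa> \<le>o ctwo ^c natLeq" and X: "crowded \<kappa> X"
  obtains X' :: "real topology" and f where "homeomorphic_map X X' f"
proof -
  have "|topspace X| \<le>o ctwo ^c natLeq"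
    using X by (intro ordIso_ordLeq_trans [OF _ \<kappa>]) (auto simp: crowded_def)
  also have "ctwo ^c natLeq =o |UNIV :: nat set set|"
    unfolding cexp_def ctwo_def Field_card_of Field_natLeq
    using card_of_Pow_Func [of "UNIV :: nat set"] ordIso_symmetric by auto
  also have "|UNIV :: nat set set| =o |UNIV :: real set|"
    using nat_sets_eqpoll_reals unfolding eqpoll_def card_of_ordIso .
  finally obtain f :: "'a \<Rightarrow> real" where f: "inj_on f (topspace X)"
    using card_of_ordLeq [of "topspace X" "UNIV :: real set"] by auto
  define g where "g = inv_into (topspace X) f"
  define X' where "X' = pullback_topology (f ` topspace X) g X"
  have gf: "g (f x) = x" if "x \<in> topspace X" for x
    using f that unfolding g_def by simp
  have top: "topspace X' = f ` topspace X"
    unfolding X'_def topspace_pullback_topology using gf by auto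
  have pre: "g -` U \<inter> f ` topspace X = f ` U" if "U \<subseteq> topspace X" for U
    using that gf by force
  have op: "openin X' S \<longleftrightarrow> (\<exists>U. openin X U \<and> S = f ` U)" for S
    unfolding X'_def openin_pullback_topology using pre [OF openin_subset] by metis
  have "homeomorphic_map X X' f"
    unfolding homeomorphic_map_def quotient_map_def
  proof (intro conjI allI impI)
    fix U assume U: "U \<subseteq> topspace X'"
    show "openin X {x \<in> topspace X. f x \<in> U} = openin X' U"
    proof
      assume "openin X {x \<in> topspace X. f x \<in> U}"
      moreover have "U = f ` {x \<in> topspace X. f x \<in> U}" using U top by auto
      ultimately show "openin X' U" using op by blast
    next
      assume "openin X' U"
      then obtain V where V: "openin X V" "U = f ` V" using op by blast
      then have "{x \<in> topspace X. f x \<in> U} = V"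
        using f openin_subset [OF V(1)] by (auto dest: inj_onD)
      then show "openin X {x \<in> topspace X. f x \<in> U}" using V by simp
    qed
  qed (use top f in auto)
  then show thesis using that by blast
qed

lemma BA_minus_all_types:
  fixes X :: "'a topology" and Y :: "'b topology"
  assumes \<kappa>: "\<kappa> \<le>o ctwo ^c natLeq" and BA: "BA_minus \<kappa>"
    and X: "separable_space X" "metrizable_space X" "zero_dimensional X" "crowded \<kappa> X"
    and Y: "separable_space Y" "metrizable_space Y" "zero_dimensional Y" "crowded \<kappa> Y"
  shows "X homeomorphic_space Y"
proof -
  obtain X' :: "real topology" and f where f: "homeomorphic_map X X' f"
    using homeomorphic_real_copy [OF \<kappa> X(4)] by blast
  obtain Y' :: "real topology" and g where g: "homeomorphic_map Y Y' g"
    using homeomorphic_real_copy [OF \<kappa> Y(4)] by blast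
  have XX': "X homeomorphic_space X'" and YY': "Y homeomorphic_space Y'"
    using f g homeomorphic_map_imp_homeomorphic_space by blast+
  have "X' homeomorphic_space Y'"
  proof (rule BA [unfolded BA_minus_def, rule_format], intro conjI)
    show "separable_space X'" "separable_space Y'" "metrizable_space X'" "metrizable_space Y'"
      using X Y homeomorphic_separable_space [OF XX'] homeomorphic_separable_space [OF YY']
        homeomorphic_metrizable_space [OF XX'] homeomorphic_metrizable_space [OF YY']
      by auto
    show "zero_dimensional X'" "zero_dimensional Y'"
      using homeomorphic_map_zero_dimensional [OF f X(3)]
        homeomorphic_map_zero_dimensional [OF g Y(3)] .
    show "crowded \<kappa> X'" "crowded \<kappa> Y'"
      using homeomorphic_map_crowded [OF f X(4)] homeomorphic_map_crowded [OF g Y(4)] .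
  qed
  then show ?thesis
    using XX' YY' by (meson homeomorphic_space_sym homeomorphic_space_trans)
qed

end

theory Submission
  imports Defs
begin

text \<open>
  Take a set \<open>K\<close> of \<open>\<kappa>\<close> irrationals that are pairwise inequivalent modulo \<open>\<rat>\<close>. For every
  \<open>T \<subseteq> K\<close>, adjoining \<open>T\<close> to the translates of \<open>K\<close> by nonzero rationals gives a \<open>\<kappa>\<close>-crowded
  zero-dimensional subspace of the line, and different \<open>T\<close> give different subspaces. If they are all
  homeomorphic, then each of them is the image of one fixed space under a continuous map, and such
  a map is determined by its values on a countable dense set. Hence there are at most
  \<open>2\<^sup>\<aleph>\<^sup>0\<close> subsets of \<open>K\<close>.
\<close>

section \<open>Cardinal arithmetic of the continuum\<close>

lemma countable_ordLeq_infinite: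
  assumes "countable A" "infinite B"
  shows "|A| \<le>o |B|"
proof -
  have "|A| \<le>o |UNIV :: nat set|"
    using assms(1) card_of_ordLeq [of A "UNIV :: nat set"] by (auto simp: countable_def)
  then show ?thesis
    using assms(2) infinite_iff_card_of_nat ordLeq_transitive by blast
qed

lemma cexp_ctwo_ordIso_Pow:
  assumes "|A| =o r" "Card_order r"
  shows "ctwo ^c r =o |Pow A|"
proof -
  have "ctwo ^c r =o ctwo ^c |A|"
    using assms by (simp add: cexp_cong2 Card_order_ctwo ordIso_symmetric card_of_Card_order)
  also have "ctwo ^c |A| =o |Pow A|"
    unfolding cexp_def ctwo_def Field_card_of
    using card_of_Pow_Func ordIso_symmetric by blast
  finally show ?thesis .
qed

lemma continuum_ordIso_nat_sets: "ctwo ^c natLeq =o |UNIV :: nat set set|"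
  using cexp_ctwo_ordIso_Pow [OF card_of_nat natLeq_Card_order] by simp

lemma continuum_ordIso_reals: "ctwo ^c natLeq =o |UNIV :: real set|"
  using continuum_ordIso_nat_sets nat_sets_eqpoll_reals
  unfolding eqpoll_def card_of_ordIso by (rule ordIso_transitive)

text \<open>Code each real by a set of naturals; the pairing function then merges a sequence of such
  sets into a single one, whose sections recover the sequence.\<close>

lemma real_sequences_ordLeq_continuum: "|UNIV :: (nat \<Rightarrow> real) set| \<le>o ctwo ^c natLeq"
proof -
  obtain g :: "real \<Rightarrow> nat set" where g: "inj g"
    using nat_sets_eqpoll_reals eqpoll_sym unfolding eqpoll_def bij_betw_def by blast
  define F where "F f = {prod_encode (n, m) |n m. m \<in> g (f n)}" for f :: "nat \<Rightarrow> real"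
  have "m \<in> g (f n) \<longleftrightarrow> prod_encode (n, m) \<in> F f" for f n m
    by (auto simp: F_def)
  then have "g (f n) = {m. prod_encode (n, m) \<in> F f}" for f n
    by blast
  then have "inj F"
    using g by (metis injI injD ext)
  then have "|UNIV :: (nat \<Rightarrow> real) set| \<le>o |UNIV :: nat set set|"
    by (rule card_of_ordLeqI) simp
  then show ?thesis
    using continuum_ordIso_nat_sets ordIso_symmetric ordLeq_ordIso_trans by blast
qed

section \<open>Irrationals inequivalent modulo \<rat>\<close>

text \<open>Choose one representative of each coset of \<rat> that meets \<open>A\<close> and drop a
  rational one. Countably many translates of \<open>K\<close>, together with \<rat>, cover
  \<open>A\<close>; as \<open>A\<close> is uncountable, \<open>K\<close> is infinite and no smaller
  than \<open>A\<close>.\<close>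

lemma irrational_transversal:
  fixes A :: "real set"
  assumes "uncountable A"
  obtains K :: "real set" where "|K| =o |A|" "K \<inter> \<rat> = {}" "\<And>x y. \<lbrakk>x \<in> K; y \<in> K; x - y \<in> \<rat>\<rbrakk> \<Longrightarrow> x = y"
proof -
  define rep where "rep x = (SOME y. x - y \<in> \<rat>)" for x :: real
  have rep: "x - rep x \<in> \<rat>" for x
    unfolding rep_def by (rule someI [where x = x]) simp
  \<comment> \<open>Equivalent points give \<open>SOME\<close> the same predicate, so the choice
    depends only on the coset.\<close>
  have rep_eq: "rep x = rep y" if "x - y \<in> \<rat>" for x y
  proof -
    have "x - z \<in> \<rat> \<longleftrightarrow> y - z \<in> \<rat>" for z
      using Rats_diff [OF _ that, of "x - z"] Rats_add [OF that, of "y - z"] by auto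
    then show ?thesis by (simp add: rep_def)
  qed
  define K where "K = rep ` A - \<rat>"
  have trans: "x = y" if xy: "x \<in> K" "y \<in> K" "x - y \<in> \<rat>" for x y
  proof -
    obtain a b where ab: "x = rep a" "y = rep b" using xy(1,2) unfolding K_def by blast
    have "a - b = (a - rep a) + (x - y) - (b - rep b)" using ab by simp
    then have "a - b \<in> \<rat>" using rep xy(3) by (metis Rats_add Rats_diff)
    then show ?thesis using ab rep_eq by simp
  qed
  have A: "A \<subseteq> (\<Union>q\<in>\<rat>. (+) q ` K) \<union> \<rat>"
  proof
    fix x assume "x \<in> A"
    show "x \<in> (\<Union>q\<in>\<rat>. (+) q ` K) \<union> \<rat>"
    proof (cases "rep x \<in> \<rat>")
      case True
      then show ?thesis using Rats_add [OF rep [of x] True] by simp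
    next
      case False
      then have "rep x \<in> K" using \<open>x \<in> A\<close> by (simp add: K_def)
      moreover have "x = (x - rep x) + rep x" by simp
      ultimately show ?thesis using rep by blast
    qed
  qed
  have inf: "infinite K"
  proof
    assume "finite K"
    then have "countable ((\<Union>q\<in>\<rat>. (+) q ` K) \<union> \<rat>)"
      by (simp add: countable_rat countable_finite)
    then show False using A assms countable_subset by blast
  qed
  have "|A| \<le>o |(\<Union>q\<in>\<rat>. (+) q ` K) \<union> \<rat>|"
    using A by (rule card_of_mono1)
  also have "|(\<Union>q\<in>\<rat>. (+) q ` K) \<union> \<rat>| \<le>o |K|"
    using inf
    by (intro card_of_Un_ordLeq_infinite_Field card_of_UNION_ordLeq_infinite)
      (auto simp: card_of_image Field_card_of card_of_card_order_on countable_rat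
        intro: countable_ordLeq_infinite)
  finally have "|A| \<le>o |K|" .
  moreover have "|K| \<le>o |A|"
    unfolding K_def by (rule ordLeq_transitive [OF card_of_mono1 card_of_image]) blast
  ultimately have "|K| =o |A|"
    by (simp add: ordIso_iff_ordLeq)
  then show thesis
    using trans by (intro that [of K]) (auto simp: K_def)
qed

section \<open>Zero-dimensional crowded subspaces of the line\<close>

text \<open>An interval with rational endpoints has a clopen trace on \<open>S\<close>, because its
  endpoints are not in \<open>S\<close>.\<close>

lemma zero_dimensional_irrationals:
  fixes S :: "real set"
  assumes "S \<inter> \<rat> = {}"
  shows "zero_dimensional (top_of_set S)"
  unfolding zero_dimensional_iff
proof (intro allI impI)
  fix U x assume U: "openin (top_of_set S) U \<and> x \<in> U"
  then obtain e where e: "e > 0" "ball x e \<inter> S \<subseteq> U" and "x \<in> S"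
    unfolding openin_contains_ball by blast
  obtain a b where ab: "a \<in> \<rat>" "b \<in> \<rat>" "x - e < a" "a < x" "x < b" "b < x + e"
    using Rats_dense_in_real [of "x - e" x] Rats_dense_in_real [of x "x + e"] e by auto
  have "S \<inter> {a<..<b} = S \<inter> {a..b}"
    using assms ab by (force simp: less_le)
  then have "closedin (top_of_set S) (S \<inter> {a<..<b})"
    by (metis closed_real_atLeastAtMost closedin_closed_Int)
  moreover have "openin (top_of_set S) (S \<inter> {a<..<b})"
    by (simp add: openin_open_Int)
  moreover have "S \<inter> {a<..<b} \<subseteq> U"
    using e(2) ab by (force simp: dist_real_def)
  moreover have "x \<in> S \<inter> {a<..<b}"
    using \<open>x \<in> S\<close> ab by simp
  ultimately show "\<exists>V. openin (top_of_set S) V \<and> closedin (top_of_set S) V \<and> x \<in> V \<and> V \<subseteq> U"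
    by blast
qed

text \<open>Every point of \<open>K\<close> has a nonzero rational translate in a given ball, and
  inequivalent points have different translates; this bounds \<open>U\<close> from below. From
  above, \<open>S\<close> lies in countably many copies of \<open>K\<close>. Translation by 0 is
  avoided in the lower bound, so it does not matter which points of \<open>K\<close> belong to
  \<open>S\<close>.\<close>

lemma crowded_rational_translates:
  fixes K S :: "real set"
  assumes K: "infinite K" "|K| =o \<kappa>"
    and trans: "\<And>x y. \<lbrakk>x \<in> K; y \<in> K; x - y \<in> \<rat>\<rbrakk> \<Longrightarrow> x = y"
    and S: "(\<Union>q\<in>\<rat> - {0}. (+) q ` K) \<subseteq> S" "S \<subseteq> (\<Union>q\<in>\<rat>. (+) q ` K)"
  shows "crowded \<kappa> (top_of_set S)"
  unfolding crowded_def
proof (intro conjI allI impI)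
  have "K \<noteq> {}" using K(1) by auto
  then show "topspace (top_of_set S) \<noteq> {}"
    using S(1) Rats_1 by fastforce
next
  fix U assume U: "openin (top_of_set S) U \<and> U \<noteq> {}"
  then obtain x e where e: "e > 0" "ball x e \<inter> S \<subseteq> U" and "U \<subseteq> S"
    unfolding openin_contains_ball by blast
  have "\<exists>q\<in>\<rat> - {0}. q + k \<in> ball x e" for k
  proof -
    \<comment> \<open>The interval from \<open>a\<close> to \<open>b\<close> is a half of the ball
      of radius \<open>e\<close> about \<open>x - k\<close> that lies on one side of 0, so a
      rational inside it is nonzero.\<close>
    define a b where "a = (if x - k < 0 then x - k - e else max 0 (x - k))"
      and "b = (if x - k < 0 then x - k else x - k + e)"
    have "a < b" using e by (auto simp: a_def b_def)
    then obtain q where q: "q \<in> \<rat>" "a < q" "q < b" using Rats_dense_in_real by blast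
    then have "q \<noteq> 0 \<and> q + k \<in> ball x e"
      using e by (auto simp: a_def b_def dist_real_def split: if_splits)
    then show ?thesis using q by blast
  qed
  then obtain p where p: "\<And>k. p k \<in> \<rat> - {0}" "\<And>k. p k + k \<in> ball x e"
    by metis
  have "inj_on (\<lambda>k. p k + k) K"
  proof (rule inj_onI)
    fix k l assume kl: "k \<in> K" "l \<in> K" "p k + k = p l + l"
    have "k - l = p l - p k" using kl(3) by simp
    then show "k = l" using p(1) kl trans by (metis DiffD1 Rats_diff)
  qed
  moreover have "p k + k \<in> U" if "k \<in> K" for k
    using p that S(1) e(2) by blast
  ultimately have "|K| \<le>o |U|"
    by (rule card_of_ordLeqI)
  moreover have "|U| \<le>o |K|"
  proof -
    have "|U| \<le>o |\<Union>q\<in>\<rat>. (+) q ` K|"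
      using \<open>U \<subseteq> S\<close> S(2) by (intro card_of_mono1) blast
    also have "|\<Union>q\<in>\<rat>. (+) q ` K| \<le>o |K|"
      using K(1)
      by (intro card_of_UNION_ordLeq_infinite) (auto simp: card_of_image countable_rat intro: countable_ordLeq_infinite)
    finally show ?thesis .
  qed
  ultimately have "|U| =o |K|"
    by (simp add: ordIso_iff_ordLeq)
  then show "|U| =o \<kappa>"
    using K(2) by (rule ordIso_transitive)
qed

lemma separable_space_top_of_set_real: "separable_space (top_of_set (S :: real set))"
proof -
  obtain D where D: "countable D" "D \<subseteq> S" "S \<subseteq> closure D"
    using separable by blast
  then have "top_of_set S closure_of D = S"
    by (auto simp: closure_of_subtopology Int_absorb1)
  then show ?thesis
    using D unfolding separable_space_def by auto
qed

section \<open>Counting continuous images\<close>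

text \<open>Continuous maps into a Hausdorff space that agree on a dense set are equal, so an image
  is determined by the sequence of values of one chosen map along a countable dense set.\<close>

lemma continuous_images_ordLeq_continuum:
  assumes "separable_space X"
  shows "|{S. \<exists>f. continuous_map X euclideanreal f \<and> S = f ` topspace X}| \<le>o ctwo ^c natLeq"
    (is "|?F| \<le>o _")
proof -
  obtain D where D: "countable D" "X closure_of D = topspace X"
    using assms unfolding separable_space_def by blast
  define f where "f S = (SOME f. continuous_map X euclideanreal f \<and> S = f ` topspace X)" for S
  have f: "continuous_map X euclideanreal (f S)" "S = f S ` topspace X" if "S \<in> ?F" for S
    using that someI_ex [of "\<lambda>f. continuous_map X euclideanreal f \<and> S = f ` topspace X"]
    by (auto simp: f_def)
  \<comment> \<open>If \<open>D\<close> is empty, \<open>from_nat_into\<close> returns an arbitrary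
    point; this is harmless, since \<open>topspace X\<close> is then empty too.\<close>
  define G where "G S n = f S (from_nat_into D n)" for S n
  have "inj_on G ?F"
  proof (rule inj_onI)
    fix S T assume ST: "S \<in> ?F" "T \<in> ?F" "G S = G T"
    have "f S d = f T d" if "d \<in> D" for d
      using fun_cong [OF ST(3)] D(1) that by (metis G_def from_nat_into_to_nat_on)
    then have "f S x = f T x" if "x \<in> topspace X" for x
      using forall_in_closure_of_eq [OF _ Hausdorff_space_euclidean f(1) [OF ST(1)] f(1) [OF ST(2)]]
        that D(2) by metis
    then show "S = T"
      using f(2) [OF ST(1)] f(2) [OF ST(2)] by (metis image_cong)
  qed
  then have "|?F| \<le>o |UNIV :: (nat \<Rightarrow> real) set|"
    by (rule card_of_ordLeqI) simp
  then show ?thesis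
    using real_sequences_ordLeq_continuum ordLeq_transitive by blast
qed

theorem lemma3p1:
  fixes \<kappa> :: "'k rel"
  assumes "Card_order \<kappa>" and "natLeq <o \<kappa>" and "\<kappa> \<le>o ctwo ^c natLeq"
    and "BA_minus \<kappa>"
  shows "ctwo ^c natLeq =o ctwo ^c \<kappa>"
proof -
  have "|Field \<kappa>| =o \<kappa>"
    using assms(1) by (rule card_of_Field_ordIso)
  moreover have "\<kappa> \<le>o |UNIV :: real set|"
    using assms(3) continuum_ordIso_reals by (rule ordLeq_ordIso_trans)
  ultimately have "|Field \<kappa>| \<le>o |UNIV :: real set|"
    by (rule ordIso_ordLeq_trans)
  \<comment> \<open>Moves \<kappa> from its own type to a set of reals, where cosets of \<rat> make
    sense.\<close>
  then obtain A :: "real set" where "|Field \<kappa>| =o |A|"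
    using iffD1 [OF internalize_card_of_ordLeq2] by blast
  then have A: "|A| =o \<kappa>"
    using \<open>|Field \<kappa>| =o \<kappa>\<close> ordIso_symmetric ordIso_transitive by blast
  have "uncountable A"
  proof
    assume "countable A"
    then have "|A| \<le>o natLeq"
      using countable_ordLeq_infinite [of A "UNIV :: nat set"] card_of_nat ordLeq_ordIso_trans
      by auto
    then have "\<kappa> \<le>o natLeq"
      using A ordIso_symmetric ordIso_ordLeq_trans by blast
    then show False
      using assms(2) not_ordLess_ordLeq by blast
  qed
  then obtain K :: "real set" where KA: "|K| =o |A|" and irr: "K \<inter> \<rat> = {}"
    and trans: "\<And>x y. \<lbrakk>x \<in> K; y \<in> K; x - y \<in> \<rat>\<rbrakk> \<Longrightarrow> x = y"
    using irrational_transversal by blast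
  have K: "|K| =o \<kappa>"
    using KA A by (rule ordIso_transitive)
  have "infinite K"
    using card_of_ordIso_finite [OF KA] \<open>uncountable A\<close> countable_finite by blast
  define S where "S T = (\<Union>q\<in>\<rat> - {0}. (+) q ` K) \<union> T" for T
  define X where "X T = top_of_set (S T)" for T
  have good: "separable_space (X T) \<and> metrizable_space (X T) \<and> zero_dimensional (X T) \<and>
      crowded \<kappa> (X T)" if "T \<subseteq> K" for T
  proof (intro conjI)
    have "T \<subseteq> (+) 0 ` K" using that by auto
    then have sub: "S T \<subseteq> (\<Union>q\<in>\<rat>. (+) q ` K)"
      unfolding S_def using Rats_0 by blast
    have "q + k \<notin> \<rat>" if "q \<in> \<rat>" "k \<in> K" for q k
      using Rats_diff [of "q + k" q] that irr by auto
    then have "S T \<inter> \<rat> = {}" using sub by blast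
    then show "zero_dimensional (X T)"
      unfolding X_def by (rule zero_dimensional_irrationals)
    show "crowded \<kappa> (X T)"
      unfolding X_def
      by (rule crowded_rational_translates [OF \<open>infinite K\<close> K trans _ sub]) (auto simp: S_def)
    show "separable_space (X T)" "metrizable_space (X T)"
      unfolding X_def
      by (simp_all add: separable_space_top_of_set_real metrizable_space_subtopology
          metrizable_space_euclidean)
  qed
  \<comment> \<open>The fixed source is \<open>X {}\<close>: a homeomorphism from it onto
    \<open>X T\<close>, read as a real-valued map, has image \<open>S T\<close>.\<close>
  define F where "F = {S. \<exists>f. continuous_map (X {}) euclideanreal f \<and> S = f ` topspace (X {})}"
  have "S T \<in> F" if "T \<subseteq> K" for T
  proof -
    have "X {} homeomorphic_space X T"
      using assms(4) good [OF that] good [of "{}"] unfolding BA_minus_def by blast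
    then obtain f where f: "homeomorphic_map (X {}) (X T) f"
      using homeomorphic_space by blast
    then have "f ` topspace (X {}) = S T"
      using homeomorphic_imp_surjective_map by (fastforce simp: X_def)
    moreover have "continuous_map (X {}) euclideanreal f"
      using homeomorphic_imp_continuous_map [OF f]
      by (simp add: X_def [of T] continuous_map_in_subtopology)
    ultimately show ?thesis unfolding F_def by blast
  qed
  \<comment> \<open>Nonzero rational translates of \<open>K\<close> miss \<open>K\<close>, so
    intersecting with \<open>K\<close> recovers \<open>T\<close>.\<close>
  moreover have "inj_on S (Pow K)"
  proof (rule inj_on_inverseI)
    fix T assume "T \<in> Pow K"
    have "q = 0" if "q \<in> \<rat>" "k \<in> K" "q + k \<in> K" for q k
      using trans [of "q + k" k] that by simp
    then have "K \<inter> (\<Union>q\<in>\<rat> - {0}. (+) q ` K) = {}" by blast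
    then show "K \<inter> S T = T"
      using \<open>T \<in> Pow K\<close> unfolding S_def by blast
  qed
  ultimately have "|Pow K| \<le>o |F|"
    by (intro card_of_ordLeqI) auto
  also have "|F| \<le>o ctwo ^c natLeq"
    unfolding F_def using good [of "{}"] by (intro continuous_images_ordLeq_continuum) simp
  finally have "ctwo ^c \<kappa> \<le>o ctwo ^c natLeq"
    using cexp_ctwo_ordIso_Pow [OF K assms(1)] by (simp add: ordIso_ordLeq_trans)
  moreover have "ctwo ^c natLeq \<le>o ctwo ^c \<kappa>"
    using assms(2) by (intro cexp_mono2_Cnotzero ordLess_imp_ordLeq Card_order_ctwo
        Cinfinite_Cnotzero natLeq_Cinfinite)
  ultimately show ?thesis
    by (simp add: ordIso_iff_ordLeq)
qed

end
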